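(* Let $c,\delta\in\mathbb{R}$ and let $N_{\infty,\delta}$ be the total number of $\delta$-records in the linear drift model $Y_n=X_n+cn$, $n\ge1$. Then $N_{\infty,\delta}<\infty$ almost surely if and only if one of the following conditions holds: (i) $c<0$ and $\mu^+<\infty$; (ii) $c=0$, $\delta>0$ and $\int_{0}^{\infty} \frac{1- F(x+\delta)}{(1-F(x))^2}f(x)\,dx<\infty$; (iii) $c>0$ and $x_+-x_-\le\delta-c$. Moreover, $N_{\infty,\delta}<\infty$ almost surely if and only if $\mathbb{E}[N_{\infty,\delta}]<\infty$.
   Context: Linear drift model: $Y_n=X_n+cn$, $n\ge1$, where $c\in\mathbb{R}$ and $(X_n)_{n\ge1}$ are iid real random variables with absolutely continuous cdf $F$ and pdf $f$. It is assumed that there are $-\infty\le x_-<x_+\le\infty$ such that $f(x)>0$ for all $x\in(x_-,x_+)$ and $f(x)=0$ otherwise; so $x_-=\inf\{x:F(x)>0\}$ and $x_+=\sup\{x:F(x)<1\}$ ($x_+-x_-=\infty$ if either endpoint is infinite). Put $\mu^+=\int_0^\infty xf(x)\,dx\in[0,\infty]$. For $\delta\in\mathbb{R}$, $Y_1$ is by convention a $\delta$-record, and for $j\ge2$, $Y_j$ is a $\delta$-record if $Y_j>\max\{Y_1,\dots,Y_{j-1}\}+\delta$. Let $1_{j,\delta}$ be the indicator of the event that $Y_j$ is a $\delta$-record, $N_{n,\delta}=\sum_{j=1}^n1_{j,\delta}$, and $N_{\infty,\delta}=\lim_{n\to\infty}N_{n,\delta}=\sum_{j=1}^\infty 1_{j,\delta}\in\mathbb{N}\cup\{\infty\}$.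 In the integral in (ii), the integrand is taken to be $0$ for $x\ge x_+$ (where $f(x)=0$ and $F(x)=1$). *)

theory Defs
  imports "HOL-Probability.Probability"
begin

text \<open>Sequences are indexed from 1; index 0 is never used.\<close>

definition linear_drift :: "(nat \<Rightarrow> 'a \<Rightarrow> real) \<Rightarrow> real \<Rightarrow> 'a \<Rightarrow> nat \<Rightarrow> real" where
  "linear_drift X c \<omega> n = X n \<omega> + c * real n"

definition delta_record :: "real \<Rightarrow> (nat \<Rightarrow> real) \<Rightarrow> nat \<Rightarrow> bool" where
  "delta_record \<delta> y j \<longleftrightarrow> j = 1 \<or> (j \<ge> 2 \<and> y j > Max (y ` {1..j-1}) + \<delta>)"

text \<open>The number of all \<open>\<delta>\<close>-records, with value \<open>\<infinity>\<close> if there are infinitely many;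
  the shift makes the summation start at index 1.\<close>

definition total_delta_records :: "real \<Rightarrow> (nat \<Rightarrow> real) \<Rightarrow> ennreal" where
  "total_delta_records \<delta> y = (\<Sum>j. of_bool (delta_record \<delta> y (Suc j)))"

definition mu_plus :: "(real \<Rightarrow> real) \<Rightarrow> ennreal" where
  "mu_plus f = (\<integral>\<^sup>+x\<in>{0..}. ennreal (x * f x) \<partial>lborel)"

text \<open>Where \<open>F x = 1\<close>, the integrand is 0, since division by zero yields 0.\<close>

definition record_integral :: "real \<Rightarrow> (real \<Rightarrow> real) \<Rightarrow> (real \<Rightarrow> real) \<Rightarrow> ennreal" where
  "record_integral \<delta> F f =
     (\<integral>\<^sup>+x\<in>{0..}. ennreal ((1 - F (x + \<delta>)) / (1 - F x)\<^sup>2 * f x) \<partial>lborel)"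

end

theory Submission
  imports Defs
begin

text \<open>Let \<open>A k\<close> be the event that \<open>Y (k + 1)\<close> is a \<open>\<delta>\<close>-record. Forgetting the past before time
  \<open>i + 2\<close> and using that increments of the drift depend only on time differences gives
  \<open>P (A i \<inter> A j) \<le> P (A i) P (A (j - i - 1))\<close> for \<open>i < j\<close>. Hence the number \<open>S\<close> of records up to a
  fixed time satisfies \<open>E S\<^sup>2 \<le> E S + 2 (E S)\<^sup>2\<close>, and by a Paley-Zygmund argument an infinite
  expectation forces infinitely many records with probability at least \<open>1/12\<close>. So everything
  reduces to the convergence of the series of
  \<open>P (A k) = \<integral> \<Prod>i=1..k. F (x + c i - \<delta>) dF(x)\<close>.

  If \<open>\<mu>\<^sup>+ = \<infinity>\<close>, then \<open>X\<close> exceeds every linear function infinitely often, which is impossible with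
  finitely many records. If \<open>\<mu>\<^sup>+ < \<infinity>\<close>, the tails \<open>1 - F (a + d k)\<close> are summable for \<open>d > 0\<close>; this
  makes the series converge for \<open>c < 0\<close>, and bounds \<open>P (A k)\<close> from below for \<open>c > 0\<close> unless
  \<open>P (A 1) = 0\<close>. For \<open>c = 0\<close> the series sums to \<open>\<integral> 1 / (1 - F (y - \<delta>)) dF(y)\<close>, which Fubini's theorem
  and the uniform distribution of \<open>F X\<close> turn into the integral of condition (ii).\<close>

subsection \<open>A second moment criterion for infinitely many renewal-type events\<close>

text \<open>A pointwise quadratic bound replaces the Cauchy-Schwarz inequality: after integration
  the first two terms contribute at most \<open>m / 2\<close> and \<open>m / 4\<close>, so
  \<open>3 * m * prob B\<close> has to supply the remaining \<open>m / 4\<close>.\<close>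

lemma (in prob_space) paley_zygmund_weak:
  fixes S :: "'a \<Rightarrow> real"
  assumes S: "integrable M S" "integrable M (\<lambda>\<omega>. (S \<omega>)\<^sup>2)"
    and pos: "0 < expectation S"
    and second: "expectation (\<lambda>\<omega>. (S \<omega>)\<^sup>2) \<le> 3 * (expectation S)\<^sup>2"
  shows "1 / 12 \<le> prob {\<omega> \<in> space M. expectation S / 2 \<le> S \<omega>}"
proof -
  define m where "m = expectation S"
  define B where "B = {\<omega> \<in> space M. m / 2 \<le> S \<omega>}"
  have [measurable]: "S \<in> borel_measurable M" using S by auto
  have B[measurable]: "B \<in> events" unfolding B_def by measurable
  have m: "0 < m" using pos by (simp add: m_def)
  \<comment> \<open>On \<open>B\<close> use \<open>s \<le> s\<^sup>2 / (2 \<lambda>) + \<lambda> / 2\<close> with \<open>\<lambda> = 6 m\<close>.\<close>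
  have ptw: "S \<omega> \<le> m / 2 + (S \<omega>)\<^sup>2 / (12 * m) + 3 * m * indicator B \<omega>"
    if "\<omega> \<in> space M" for \<omega>
  proof (cases "\<omega> \<in> B")
    case True
    have "0 \<le> (S \<omega> - 6 * m)\<^sup>2 / (12 * m)" using m by simp
    also have "\<dots> = (S \<omega>)\<^sup>2 / (12 * m) - S \<omega> + 3 * m"
      using m by (simp add: field_simps power2_eq_square)
    finally show ?thesis using True m by simp
  next
    case False
    then have "S \<omega> \<le> m / 2" using that by (auto simp: B_def)
    moreover have "0 \<le> (S \<omega>)\<^sup>2 / (12 * m)" using m by simp
    ultimately show ?thesis using False by simp
  qed
  have "m \<le> expectation (\<lambda>\<omega>. m / 2 + (S \<omega>)\<^sup>2 / (12 * m) + 3 * m * indicator B \<omega>)"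
    using S ptw
    by (subst m_def, intro integral_mono) (auto simp: integrable_real_indicator emeasure_eq_measure)
  also have "\<dots> = m / 2 + expectation (\<lambda>\<omega>. (S \<omega>)\<^sup>2) / (12 * m) + 3 * m * prob B"
    using S by (simp add: emeasure_eq_measure prob_space)
  also have "\<dots> \<le> m / 2 + 3 * m\<^sup>2 / (12 * m) + 3 * m * prob B"
    using second m by (intro add_mono divide_right_mono) (auto simp: m_def)
  also have "\<dots> = m * (3 / 4 + 3 * prob B)"
    using m by (simp add: field_simps power2_eq_square)
  finally have "1 \<le> 3 / 4 + 3 * prob B" using m by simp
  then show ?thesis by (simp add: B_def m_def)
qed

text \<open>The square expands into a sum over pairs: the diagonal gives \<open>m n\<close>, and
  each of the two triangles is at most the square of \<open>m n\<close> by the renewal inequality.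
  As index \<open>k\<close> stands for time \<open>k + 1\<close>, restarting after event
  \<open>i\<close> turns event \<open>j\<close> into number \<open>j - Suc i\<close>.\<close>

lemma (in prob_space) second_moment_renewal:
  assumes A[measurable]: "\<And>k. A k \<in> events"
    and ren: "\<And>i j. i < j \<Longrightarrow> prob (A i \<inter> A j) \<le> prob (A i) * prob (A (j - Suc i))"
  defines "S \<equiv> \<lambda>n \<omega>. \<Sum>k<n. indicator (A k) \<omega> :: real"
    and "m \<equiv> \<lambda>n. \<Sum>k<n. prob (A k)"
  shows "integrable M (S n)" "integrable M (\<lambda>\<omega>. (S n \<omega>)\<^sup>2)"
    and "expectation (S n) = m n"
    and "expectation (\<lambda>\<omega>. (S n \<omega>)\<^sup>2) \<le> m n + 2 * (m n)\<^sup>2"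
proof -
  have sq: "(S n \<omega>)\<^sup>2 = (\<Sum>i<n. \<Sum>j<n. indicator (A i \<inter> A j) \<omega>)" for \<omega>
    by (simp add: S_def power2_eq_square sum_product indicator_inter_arith)
  show "integrable M (S n)"
    unfolding S_def by (auto intro!: integrable_real_indicator simp: emeasure_eq_measure)
  show "integrable M (\<lambda>\<omega>. (S n \<omega>)\<^sup>2)"
    unfolding sq by (auto intro!: integrable_real_indicator simp: emeasure_eq_measure)
  show "expectation (S n) = m n"
    unfolding S_def m_def by (subst Bochner_Integration.integral_sum)
      (auto intro!: integrable_real_indicator simp: emeasure_eq_measure)
  define q where "q k = prob (A k)" for k
  define r where "r i j = (if i < j then q i * q (j - Suc i) else 0)" for i j
  have "expectation (\<lambda>\<omega>. (S n \<omega>)\<^sup>2) = (\<Sum>i<n. \<Sum>j<n. prob (A i \<inter> A j))"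
    unfolding sq
    by (subst Bochner_Integration.integral_sum | auto intro!: integrable_real_indicator sum.cong simp: emeasure_eq_measure)+
  also have "\<dots> \<le> (\<Sum>i<n. \<Sum>j<n. (if i = j then q i else 0) + r i j + r j i)"
  proof (intro sum_mono)
    fix i j show "prob (A i \<inter> A j) \<le> (if i = j then q i else 0) + r i j + r j i"
      using ren[of i j] ren[of j i]
      by (cases i j rule: linorder_cases) (auto simp: r_def q_def Int_commute)
  qed
  also have "\<dots> = m n + ((\<Sum>i<n. \<Sum>j<n. r i j) + (\<Sum>i<n. \<Sum>j<n. r j i))"
    by (simp add: sum.distrib m_def q_def)
  also have "(\<Sum>i<n. \<Sum>j<n. r j i) = (\<Sum>i<n. \<Sum>j<n. r i j)"
    by (rule sum.swap)
  also have "(\<Sum>i<n. \<Sum>j<n. r i j) \<le> (\<Sum>i<n. q i * m n)"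
  proof (rule sum_mono)
    fix i assume "i \<in> {..<n}"
    have "(\<Sum>j<n. r i j) = (\<Sum>j\<in>{Suc i..<n}. q i * q (j - Suc i))"
      unfolding r_def by (rule sum.mono_neutral_cong_right) auto
    also have "\<dots> = q i * (\<Sum>k<n - Suc i. q k)"
      unfolding sum_distrib_left
      by (rule sum.reindex_bij_witness[of _ "\<lambda>k. k + Suc i" "\<lambda>j. j - Suc i"]) auto
    also have "\<dots> \<le> q i * m n"
      unfolding m_def q_def by (intro mult_left_mono sum_mono2) auto
    finally show "(\<Sum>j<n. r i j) \<le> q i * m n" .
  qed
  also have "(\<Sum>i<n. q i * m n) = (m n)\<^sup>2"
    by (simp add: m_def q_def power2_eq_square sum_distrib_right)
  finally show "expectation (\<lambda>\<omega>. (S n \<omega>)\<^sup>2) \<le> m n + 2 * (m n)\<^sup>2" by simp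
qed

text \<open>A finite expectation always gives almost sure finiteness. Conversely, if the count is
  almost surely finite, it is unlikely to reach some level \<open>K\<close>, while large partial
  means would make this likely; so the partial means are bounded.\<close>

lemma (in prob_space) AE_finite_iff_expectation_finite_renewal:
  assumes A[measurable]: "\<And>k. A k \<in> events"
    and ren: "\<And>i j. i < j \<Longrightarrow> prob (A i \<inter> A j) \<le> prob (A i) * prob (A (j - Suc i))"
  shows "(AE \<omega> in M. (\<Sum>k. indicator (A k) \<omega>) < (\<infinity> :: ennreal)) \<longleftrightarrow> (\<Sum>k. emeasure M (A k)) < \<infinity>"
proof
  have eq: "(\<integral>\<^sup>+\<omega>. (\<Sum>k. indicator (A k) \<omega>) \<partial>M) = (\<Sum>k. emeasure M (A k))"
    by (subst nn_integral_suminf) auto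
  show "AE \<omega> in M. (\<Sum>k. indicator (A k) \<omega>) < (\<infinity> :: ennreal)"
    if "(\<Sum>k. emeasure M (A k)) < \<infinity>"
    using nn_integral_PInf_AE[of "\<lambda>\<omega>. \<Sum>k. indicator (A k) \<omega>" M] that eq
    by (auto simp: less_top)
next
  assume fin: "AE \<omega> in M. (\<Sum>k. indicator (A k) \<omega>) < (\<infinity> :: ennreal)"
  define N where "N \<omega> = (\<Sum>k. indicator (A k) \<omega> :: ennreal)" for \<omega>
  have [measurable]: "N \<in> borel_measurable M" unfolding N_def by measurable
  define B where "B K = {\<omega> \<in> space M. of_nat K \<le> N \<omega>}" for K :: nat
  have [measurable]: "B K \<in> events" for K unfolding B_def by measurable
  have "(\<lambda>K. prob (B K)) \<longlonglongrightarrow> prob (\<Inter>K. B K)"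
    by (intro finite_Lim_measure_decseq) (auto simp: decseq_def B_def intro: order_trans[rotated])
  also have "prob (\<Inter>K. B K) = 0"
  proof -
    have "AE \<omega> in M. \<omega> \<notin> (\<Inter>K. B K)"
      using fin
    proof eventually_elim
      case (elim \<omega>)
      then obtain K where "N \<omega> < of_nat K"
        using ennreal_Ex_less_of_nat[of "N \<omega>"] unfolding N_def by auto
      then show ?case by (auto simp: B_def not_le intro!: exI[of _ K])
    qed
    then show ?thesis by (subst prob_eq_0) auto
  qed
  finally obtain K where K: "prob (B K) < 1 / 12"
    using order_tendstoD(2)[of "\<lambda>K. prob (B K)" 0 sequentially "1/12"]
    by (auto simp: eventually_sequentially)
  define m where "m n = (\<Sum>k<n. prob (A k))" for n
  \<comment> \<open>Above this bound, \<open>1 \<le> m n\<close> turns the second moment estimate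
    into \<open>3\<close> times the squared mean, and \<open>2 * real K \<le> m n\<close> puts half
    the mean above \<open>K\<close>.\<close>
  have bd: "m n \<le> max 1 (2 * real K)" for n
  proof (rule ccontr)
    assume "\<not> ?thesis"
    then have m: "1 \<le> m n" "2 * real K \<le> m n" by auto
    define S where "S \<omega> = (\<Sum>k<n. indicator (A k) \<omega> :: real)" for \<omega>
    note sm = second_moment_renewal[of A n, OF A ren, simplified, folded S_def m_def]
    have "m n \<le> (m n)\<^sup>2" using m by (simp add: power2_eq_square)
    then have "1 / 12 \<le> prob {\<omega> \<in> space M. m n / 2 \<le> S \<omega>}"
      using paley_zygmund_weak[of S] sm m by simp
    also have "\<dots> \<le> prob (B K)"
    proof (rule finite_measure_mono)
      show "{\<omega> \<in> space M. m n / 2 \<le> S \<omega>} \<subseteq> B K"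
      proof safe
        fix \<omega> assume \<omega>: "\<omega> \<in> space M" "m n / 2 \<le> S \<omega>"
        have "of_nat K = ennreal (real K)" by (simp add: ennreal_of_nat_eq_real_of_nat)
        also have "\<dots> \<le> ennreal (S \<omega>)" using \<omega> m by (intro ennreal_leI) simp
        also have "\<dots> = (\<Sum>k<n. indicator (A k) \<omega>)"
          unfolding S_def by (subst sum_ennreal[symmetric]) (auto simp: ennreal_indicator)
        also have "\<dots> \<le> N \<omega>" unfolding N_def by (rule sum_le_suminf) auto
        finally show "\<omega> \<in> B K" using \<omega> by (simp add: B_def)
      qed
    qed auto
    finally show False using K by simp
  qed
  have "(\<Sum>k. emeasure M (A k)) \<le> ennreal (max 1 (2 * real K))"
  proof (rule suminf_le_const)
    fix n
    have "(\<Sum>k<n. emeasure M (A k)) = ennreal (m n)"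
      unfolding m_def by (subst sum_ennreal[symmetric]) (auto simp: emeasure_eq_measure)
    then show "(\<Sum>k<n. emeasure M (A k)) \<le> ennreal (max 1 (2 * real K))"
      using bd[of n] by (simp only: ennreal_leI)
  qed auto
  then show "(\<Sum>k. emeasure M (A k)) < \<infinity>"
    by (rule le_less_trans) simp
qed

subsection \<open>Record probabilities\<close>

text \<open>Moving the drift to one side leaves offsets that depend only on time differences, the
  source of stationarity below. For \<open>k = 0\<close> the condition is vacuous, matching the
  convention for the first observation.\<close>

lemma delta_record_Suc_iff:
  "delta_record \<delta> (linear_drift X c \<omega>) (Suc k) \<longleftrightarrow>
    (\<forall>i\<in>{1..k}. X i \<omega> + (c * (real i - real (Suc k)) + \<delta>) < X (Suc k) \<omega>)"
proof (cases "k = 0")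
  case False
  then have "{1..k} \<noteq> {}" by auto
  then have "Max (linear_drift X c \<omega> ` {1..k}) < linear_drift X c \<omega> (Suc k) - \<delta> \<longleftrightarrow>
      (\<forall>i\<in>{1..k}. linear_drift X c \<omega> i < linear_drift X c \<omega> (Suc k) - \<delta>)"
    by (subst Max_less_iff) auto
  then show ?thesis
    using False by (simp add: delta_record_def linear_drift_def algebra_simps less_diff_eq)
qed (simp add: delta_record_def)

locale iid_sequence = prob_space M for M :: "'a measure" +
  fixes X :: "nat \<Rightarrow> 'a \<Rightarrow> real" and D :: "real measure"
  assumes indep: "indep_vars (\<lambda>_. borel) X {1..}"
    and distr_X: "\<And>n. 1 \<le> n \<Longrightarrow> distr M borel (X n) = D"
begin

lemma measurable_X [measurable]: "1 \<le> n \<Longrightarrow> X n \<in> borel_measurable M"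
  using indep by (auto simp: indep_vars_def)

lemma real_distribution_D: "real_distribution D"
  using distr_X[of 1] measurable_X[of 1] real_distribution_distr by fastforce

sublocale D: real_distribution D
  by (rule real_distribution_D)

lemma prob_X: "1 \<le> n \<Longrightarrow> A \<in> sets borel \<Longrightarrow> prob (X n -` A \<inter> space M) = measure D A"
  using distr_X[of n] measure_distr[of "X n" M borel A] by simp

lemma borel_measurable_below [measurable]: "(\<lambda>x. measure D {..<x}) \<in> borel_measurable borel"
  by (intro borel_measurable_mono monoI D.finite_measure_mono) auto

text \<open>Fubini's theorem conditions on \<open>X j\<close>, which is independent of the family
  over \<open>I\<close>; for a fixed value of \<open>X j\<close> the comparisons are independent of
  each other.\<close>

lemma emeasure_exceeds_all:
  assumes I: "finite I" "I \<subseteq> {1..}" and j: "1 \<le> j" "j \<notin> I"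
  shows "emeasure M {\<omega> \<in> space M. \<forall>i\<in>I. X i \<omega> + a i < X j \<omega>}
    = (\<integral>\<^sup>+x. (\<Prod>i\<in>I. ennreal (measure D {..<x - a i})) \<partial>D)"
proof -
  \<comment> \<open>The single variable \<open>X j\<close> is treated as a family over
    \<open>{j}\<close>, so that independence of disjoint blocks of indices yields a product
    law.\<close>
  define W where "W = (\<lambda>\<omega>. restrict (\<lambda>i. X i \<omega>) {j})"
  define V where "V = (\<lambda>\<omega>. restrict (\<lambda>i. X i \<omega>) I)"
  define Q where "Q = (\<Pi>\<^sub>M i\<in>{j}. borel :: real measure)"
  define P where "P = (\<Pi>\<^sub>M i\<in>I. borel :: real measure)"
  have Xi[measurable]: "i \<in> I \<Longrightarrow> X i \<in> borel_measurable M" for i using I by auto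
  have Xj[measurable]: "X j \<in> borel_measurable M" using j by auto
  have V[measurable]: "V \<in> measurable M P" unfolding V_def P_def by measurable
  have W[measurable]: "W \<in> measurable M Q" unfolding W_def Q_def by (measurable, use j in auto)
  have Qj[measurable]: "(\<lambda>w. w j) \<in> borel_measurable Q" unfolding Q_def by measurable
  have joint: "distr M (Q \<Otimes>\<^sub>M P) (\<lambda>\<omega>. (W \<omega>, V \<omega>)) = distr M Q W \<Otimes>\<^sub>M distr M P V"
    using indep_var_restrict[OF indep, of "{j}" I] I j
    unfolding indep_var_distribution_eq V_def W_def P_def Q_def by auto
  define E where "E = {z \<in> space (Q \<Otimes>\<^sub>M P). \<forall>i\<in>I. snd z i + a i < fst z j}"
  have comp[measurable]: "(\<lambda>z. snd z i) \<in> borel_measurable (Q \<Otimes>\<^sub>M P)" if "i \<in> I" for i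
    unfolding P_def using that by measurable
  have E[measurable]: "E \<in> sets (Q \<Otimes>\<^sub>M P)"
    unfolding E_def using I(1) by measurable
  have m1: "(\<lambda>x. \<Prod>i\<in>I. ennreal (measure D {..<x - a i})) \<in> borel_measurable borel"
    by measurable
  have m2: "(\<lambda>w. \<Prod>i\<in>I. ennreal (measure D {..<w j - a i})) \<in> borel_measurable Q"
    by (rule measurable_compose[OF Qj m1])
  interpret V: prob_space "distr M P V" by (rule prob_space_distr) measurable
  have "emeasure M {\<omega> \<in> space M. \<forall>i\<in>I. X i \<omega> + a i < X j \<omega>}
      = emeasure (distr M (Q \<Otimes>\<^sub>M P) (\<lambda>\<omega>. (W \<omega>, V \<omega>))) E"
    using measurable_space[OF V] measurable_space[OF W]
    by (subst emeasure_distr) (measurable, auto simp: E_def space_pair_measure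
        V_def[THEN fun_cong] W_def[THEN fun_cong] intro!: arg_cong[where f="emeasure M"])
  also have "\<dots> = (\<integral>\<^sup>+w. emeasure (distr M P V) (Pair w -` E) \<partial>distr M Q W)"
    unfolding joint by (rule V.emeasure_pair_measure_alt) (use E in \<open>simp cong: sets_pair_measure_cong\<close>)
  also have "\<dots> = (\<integral>\<^sup>+w. (\<Prod>i\<in>I. ennreal (measure D {..<w j - a i})) \<partial>distr M Q W)"
  proof (rule nn_integral_cong)
    fix w assume "w \<in> space (distr M Q W)"
    then have w: "w \<in> space Q" by simp
    define x where "x = w j"
    have "emeasure (distr M P V) (Pair w -` E) = emeasure M (V -` (Pair w -` E) \<inter> space M)"
      by (rule emeasure_distr) (use sets_Pair1[OF E] in auto)
    also have "V -` (Pair w -` E) \<inter> space M = {\<omega> \<in> space M. \<forall>i\<in>I. X i \<omega> < x - a i}"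
      using measurable_space[OF V] by (auto simp: E_def space_pair_measure V_def x_def less_diff_eq w)
    also have "emeasure M \<dots> = (\<Prod>i\<in>I. ennreal (measure D {..<x - a i}))"
    proof (cases "I = {}")
      case False
      have "{\<omega> \<in> space M. \<forall>i\<in>I. X i \<omega> < x - a i} = (\<Inter>i\<in>I. X i -` {..<x - a i} \<inter> space M)"
        using False by auto
      then have "prob {\<omega> \<in> space M. \<forall>i\<in>I. X i \<omega> < x - a i} = (\<Prod>i\<in>I. prob (X i -` {..<x - a i} \<inter> space M))"
        using indep_varsD[OF indep False I] by simp
      also have "\<dots> = (\<Prod>i\<in>I. measure D {..<x - a i})"
        using I by (intro prod.cong prob_X) auto
      finally show ?thesis by (simp add: emeasure_eq_measure prod_ennreal)
    qed (simp add: emeasure_space_1)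
    finally show "emeasure (distr M P V) (Pair w -` E) = (\<Prod>i\<in>I. ennreal (measure D {..<w j - a i}))"
      by (simp add: x_def)
  qed
  also have "\<dots> = (\<integral>\<^sup>+x. (\<Prod>i\<in>I. ennreal (measure D {..<x - a i})) \<partial>distr M borel (X j))"
    using j m1 m2 by (simp add: nn_integral_distr[OF W] nn_integral_distr[OF Xj] W_def[THEN fun_cong])
  also have "distr M borel (X j) = D" using j by (rule_tac distr_X)
  finally show ?thesis .
qed

end

text \<open>The probability that an observation with \<open>k\<close> predecessors is a record,
  where \<open>i\<close> counts backwards in time. It involves the common law only, so the
  convergence of its series can largely be studied without the random sequence.\<close>

definition record_prob :: "real measure \<Rightarrow> real \<Rightarrow> real \<Rightarrow> nat \<Rightarrow> ennreal" where
  "record_prob D c \<delta> k = (\<integral>\<^sup>+x. (\<Prod>i\<in>{1..k}. ennreal (measure D {..<x + c * real i - \<delta>})) \<partial>D)"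

section \<open>Records relative to a truncated past\<close>

context iid_sequence
begin

text \<open>The starting time \<open>m\<close> lets the past be forgotten: \<open>m = 1\<close>
  describes the actual records, and \<open>m = j\<close> the whole space.\<close>

definition record_from :: "real \<Rightarrow> real \<Rightarrow> nat \<Rightarrow> nat \<Rightarrow> 'a set" where
  "record_from c \<delta> m j =
    {\<omega> \<in> space M. \<forall>i\<in>{m..<j}. X i \<omega> + (c * (real i - real j) + \<delta>) < X j \<omega>}"

lemma sets_record_from [measurable]: "1 \<le> m \<Longrightarrow> m \<le> j \<Longrightarrow> record_from c \<delta> m j \<in> events"
  unfolding record_from_def by measurable

lemma emeasure_record_from:
  assumes "1 \<le> m" "m \<le> j"
  shows "emeasure M (record_from c \<delta> m j) = record_prob D c \<delta> (j - m)"
proof -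
  have "emeasure M (record_from c \<delta> m j)
    = (\<integral>\<^sup>+x. (\<Prod>i\<in>{m..<j}. ennreal (measure D {..<x - (c * (real i - real j) + \<delta>)})) \<partial>D)"
    unfolding record_from_def using assms by (intro emeasure_exceeds_all) auto
  also have "(\<lambda>x. \<Prod>i\<in>{m..<j}. ennreal (measure D {..<x - (c * (real i - real j) + \<delta>)}))
      = (\<lambda>x. \<Prod>i\<in>{1..j - m}. ennreal (measure D {..<x + c * real i - \<delta>}))"
    using assms
    by (intro ext prod.reindex_bij_witness[of _ "\<lambda>i. j - i" "\<lambda>i. j - i"])
      (auto simp: of_nat_diff algebra_simps)
  finally show ?thesis by (simp add: record_prob_def)
qed

text \<open>Dropping the comparisons with times up to \<open>i\<close> enlarges the later event and
  makes it a function of the observations after time \<open>i\<close>, hence independent of the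
  earlier event.\<close>

lemma prob_record_from_Int_le:
  assumes "1 \<le> i" "i < j"
  shows "prob (record_from c \<delta> 1 i \<inter> record_from c \<delta> 1 j)
    \<le> prob (record_from c \<delta> 1 i) * prob (record_from c \<delta> (Suc i) j)"
proof -
  define V where "V I \<omega> = restrict (\<lambda>i. X i \<omega>) I" for I \<omega>
  define P where "P I = (\<Pi>\<^sub>M i\<in>I. borel :: real measure)" for I :: "nat set"
  define E where "E m j = {v \<in> space (P {m..j}). \<forall>i\<in>{m..<j}. v i + (c * (real i - real j) + \<delta>) < v j}" for m j
  have E: "E m j \<in> sets (P {m..j})" if "m \<le> j" for m j
    unfolding E_def P_def using that by measurable
  have rec: "record_from c \<delta> m j = V {m..j} -` E m j \<inter> space M" if "1 \<le> m" "m \<le> j" for m j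
    using that by (auto simp: record_from_def E_def V_def P_def space_PiM)
  have "indep_var (P {1..i}) (V {1..i}) (P {Suc i..j}) (V {Suc i..j})"
    unfolding V_def P_def using assms by (intro indep_var_restrict[OF indep]) auto
  from indep_varD[OF this E[of 1 i] E[of "Suc i" j]] assms
  have "prob (record_from c \<delta> 1 i \<inter> record_from c \<delta> (Suc i) j)
      = prob (record_from c \<delta> 1 i) * prob (record_from c \<delta> (Suc i) j)"
    by (simp add: rec vimage_Times Int_def conj_ac)
  moreover have "record_from c \<delta> 1 j \<subseteq> record_from c \<delta> (Suc i) j"
    by (auto simp: record_from_def)
  then have "prob (record_from c \<delta> 1 i \<inter> record_from c \<delta> 1 j)
      \<le> prob (record_from c \<delta> 1 i \<inter> record_from c \<delta> (Suc i) j)"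
    using assms by (intro finite_measure_mono) auto
  ultimately show ?thesis by simp
qed

lemma total_delta_records_eq:
  assumes "\<omega> \<in> space M"
  shows "total_delta_records \<delta> (linear_drift X c \<omega>) = (\<Sum>k. indicator (record_from c \<delta> 1 (Suc k)) \<omega>)"
  unfolding total_delta_records_def delta_record_Suc_iff
  using assms by (auto simp: record_from_def atLeastLessThanSuc_atLeastAtMost indicator_def intro!: suminf_cong)

lemma nn_integral_total_delta_records:
  "(\<integral>\<^sup>+\<omega>. total_delta_records \<delta> (linear_drift X c \<omega>) \<partial>M) = (\<Sum>k. record_prob D c \<delta> k)"
proof -
  have "(\<integral>\<^sup>+\<omega>. total_delta_records \<delta> (linear_drift X c \<omega>) \<partial>M)
      = (\<integral>\<^sup>+\<omega>. (\<Sum>k. indicator (record_from c \<delta> 1 (Suc k)) \<omega>) \<partial>M)"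
    by (rule nn_integral_cong) (rule total_delta_records_eq)
  also have "\<dots> = (\<Sum>k. emeasure M (record_from c \<delta> 1 (Suc k)))"
    by (subst nn_integral_suminf) auto
  finally show ?thesis by (simp add: emeasure_record_from)
qed

lemma AE_finite_iff_record_prob:
  "(AE \<omega> in M. total_delta_records \<delta> (linear_drift X c \<omega>) < \<infinity>) \<longleftrightarrow> (\<Sum>k. record_prob D c \<delta> k) < \<infinity>"
proof -
  have "(AE \<omega> in M. (\<Sum>k. indicator (record_from c \<delta> 1 (Suc k)) \<omega>) < (\<infinity>::ennreal))
      \<longleftrightarrow> (\<Sum>k. emeasure M (record_from c \<delta> 1 (Suc k))) < \<infinity>"
  proof (rule AE_finite_iff_expectation_finite_renewal)
    fix i j :: nat assume "i < j"
    then show "prob (record_from c \<delta> 1 (Suc i) \<inter> record_from c \<delta> 1 (Suc j))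
        \<le> prob (record_from c \<delta> 1 (Suc i)) * prob (record_from c \<delta> 1 (Suc (j - Suc i)))"
      \<comment> \<open>The restarted record and the one counted from time 1 both have
        \<open>j - Suc i\<close> predecessors, so their probabilities agree.\<close>
      using prob_record_from_Int_le[of "Suc i" "Suc j" c \<delta>]
        emeasure_record_from[of "Suc (Suc i)" "Suc j" c \<delta>] emeasure_record_from[of 1 "Suc (j - Suc i)" c \<delta>]
      by (simp add: measure_def)
  qed auto
  then show ?thesis
    by (simp add: emeasure_record_from total_delta_records_eq cong: AE_cong_simp)
qed

end

subsection \<open>Infinite mean of the positive part\<close>

lemma count_multiples_le:
  assumes "0 < (K::real)"
  shows "(\<Sum>k<n. of_bool (K * real (Suc k) < y)) \<le> max 0 (y / K)"
proof (induction n)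
  case (Suc n)
  show ?case
  proof (cases "K * real (Suc n) < y")
    case True
    have "(\<Sum>k<Suc n. of_bool (K * real (Suc k) < y)) \<le> (\<Sum>k<Suc n. 1 :: real)"
      by (rule sum_mono) auto
    also have "\<dots> \<le> y / K" using True assms by (simp add: field_simps)
    finally show ?thesis by simp
  qed (use Suc in simp)
qed simp

lemma count_multiples_ge:
  assumes "0 < (K::real)"
  shows "\<exists>n. y / K - 1 \<le> (\<Sum>k<n. of_bool (K * real (Suc k) < y))"
proof (intro exI)
  \<comment> \<open>The first \<open>n\<close> positive multiples of \<open>K\<close> are exactly
    those strictly below \<open>y\<close>; the conversion to \<open>nat\<close> gives 0 if there are
    none.\<close>
  define n where "n = nat (\<lceil>y / K\<rceil> - 1)"
  have "y / K - 1 \<le> real n" unfolding n_def by linarith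
  also have "\<dots> = (\<Sum>k<n. of_bool (K * real (Suc k) < y))"
  proof -
    have "K * real (Suc k) < y" if "k < n" for k
    proof -
      have "real (Suc k) < y / K" using that unfolding n_def by linarith
      then show ?thesis using assms by (simp add: field_simps)
    qed
    then show ?thesis by simp
  qed
  finally show "y / K - 1 \<le> (\<Sum>k<n. of_bool (K * real (Suc k) < y))" .
qed

text \<open>The number of positive multiples of \<open>K\<close> below \<open>x - a\<close> is
  comparable, up to constants, with the positive part of \<open>x\<close>; integrating this count
  gives the tail sum. As \<open>ennreal\<close> sends negative numbers to 0, the integral on the
  right is the mean of the positive part.\<close>

lemma (in real_distribution) tail_sum_finite_iff:
  assumes K: "0 < K"
  shows "(\<Sum>k. emeasure M {a + K * real (Suc k)<..}) < \<infinity> \<longleftrightarrow> (\<integral>\<^sup>+x. ennreal x \<partial>M) < \<infinity>"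
proof -
  define T where "T x = (\<Sum>k. of_bool (K * real (Suc k) < x - a) :: ennreal)" for x
  have part: "(\<Sum>k<n. of_bool (K * real (Suc k) < x - a) :: ennreal)
      = ennreal (\<Sum>k<n. of_bool (K * real (Suc k) < x - a))" for n x
    by (simp add: ennreal_of_nat_eq_real_of_nat)
  have up: "T x \<le> ennreal (1 / K) * (ennreal x + ennreal \<bar>a\<bar>)" for x
    unfolding T_def
  proof (rule suminf_le_const)
    fix n
    have "(\<Sum>k<n. of_bool (K * real (Suc k) < x - a)) \<le> max 0 ((x - a) / K)"
      by (rule count_multiples_le[OF K])
    also have "\<dots> = 1 / K * max 0 (x - a)"
      using K by (auto simp: field_simps max_def)
    also have "\<dots> \<le> 1 / K * (max 0 x + \<bar>a\<bar>)"
      using K by (intro mult_left_mono) auto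
    finally have "ennreal (\<Sum>k<n. of_bool (K * real (Suc k) < x - a)) \<le> ennreal (1 / K * (max 0 x + \<bar>a\<bar>))"
      by (rule ennreal_leI)
    also have "\<dots> = ennreal (1 / K) * (ennreal x + ennreal \<bar>a\<bar>)"
      using K by (subst ennreal_mult) (auto simp: max_def ennreal_neg simp flip: ennreal_plus)
    finally show "(\<Sum>k<n. of_bool (K * real (Suc k) < x - a)) \<le> ennreal (1 / K) * (ennreal x + ennreal \<bar>a\<bar>)"
      by (simp only: part)
  qed auto
  have low: "ennreal x \<le> ennreal (\<bar>a\<bar> + K) + ennreal K * T x" for x
  proof -
    obtain n where n: "(x - a) / K - 1 \<le> (\<Sum>k<n. of_bool (K * real (Suc k) < x - a))" (is "_ \<le> ?s")
      using count_multiples_ge[OF K] by blast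
    have "x \<le> \<bar>a\<bar> + K + K * ?s" using n K by (simp add: field_simps) 
    then have "ennreal x \<le> ennreal (\<bar>a\<bar> + K + K * ?s)" by (rule ennreal_leI)
    also have "\<dots> = ennreal (\<bar>a\<bar> + K) + ennreal K * ennreal ?s"
      using K by (simp add: ennreal_mult ennreal_plus sum_nonneg)
    also have "\<dots> \<le> ennreal (\<bar>a\<bar> + K) + ennreal K * T x"
      unfolding T_def part[symmetric] by (intro add_left_mono mult_left_mono sum_le_suminf) auto
    finally show ?thesis .
  qed
  have T[measurable]: "T \<in> borel_measurable borel" unfolding T_def by measurable
  have eq: "(\<integral>\<^sup>+x. T x \<partial>M) = (\<Sum>k. emeasure M {a + K * real (Suc k)<..})"
  proof -
    have "of_bool (K * real (Suc k) < x - a) = (indicator {a + K * real (Suc k)<..} x :: ennreal)" for k x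
      by (auto simp: indicator_def)
    then show ?thesis unfolding T_def by (simp add: nn_integral_suminf del: of_nat_Suc)
  qed
  show ?thesis
  proof
    assume "(\<Sum>k. emeasure M {a + K * real (Suc k)<..}) < \<infinity>"
    then have fin: "(\<integral>\<^sup>+x. T x \<partial>M) < \<infinity>" by (simp only: eq)
    have "(\<integral>\<^sup>+x. ennreal x \<partial>M) \<le> (\<integral>\<^sup>+x. ennreal (\<bar>a\<bar> + K) + ennreal K * T x \<partial>M)"
      by (intro nn_integral_mono low)
    also have "\<dots> = ennreal (\<bar>a\<bar> + K) + ennreal K * (\<integral>\<^sup>+x. T x \<partial>M)"
      by (simp add: nn_integral_add nn_integral_cmult emeasure_space_1[simplified])
    also have "\<dots> < \<infinity>" using fin by (simp add: ennreal_mult_less_top)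
    finally show "(\<integral>\<^sup>+x. ennreal x \<partial>M) < \<infinity>" .
  next
    assume fin: "(\<integral>\<^sup>+x. ennreal x \<partial>M) < \<infinity>"
    have "(\<integral>\<^sup>+x. T x \<partial>M) \<le> (\<integral>\<^sup>+x. ennreal (1 / K) * (ennreal x + ennreal \<bar>a\<bar>) \<partial>M)"
      by (intro nn_integral_mono up)
    also have "\<dots> = ennreal (1 / K) * ((\<integral>\<^sup>+x. ennreal x \<partial>M) + ennreal \<bar>a\<bar>)"
      by (simp add: nn_integral_add nn_integral_cmult emeasure_space_1[simplified])
    also have "\<dots> < \<infinity>" using fin by (simp add: ennreal_mult_less_top)
    finally show "(\<Sum>k. emeasure M {a + K * real (Suc k)<..}) < \<infinity>" by (simp only: eq)
  qed
qed

text \<open>After the last record, every value exceeds some earlier one by at most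
  \<open>\<delta>\<close>, so induction gives growth of slope at most
  \<open>\<bar>\<delta>\<bar>\<close>; the absolute value covers negative
  \<open>\<delta>\<close>.\<close>

lemma total_delta_records_finite_imp_linear_growth:
  assumes "total_delta_records \<delta> y < \<infinity>"
  shows "\<exists>C. \<forall>j\<ge>1. y j \<le> C + \<bar>\<delta>\<bar> * real j"
proof -
  have "summable (\<lambda>j. of_bool (delta_record \<delta> y (Suc j)) :: real)"
  proof (rule summable_suminf_not_top)
    have "ennreal (of_bool P) = of_bool P" for P by simp
    then show "(\<Sum>j. ennreal (of_bool (delta_record \<delta> y (Suc j)))) \<noteq> \<top>"
      using assms by (simp add: total_delta_records_def)
  qed simp
  then have "(\<lambda>j. of_bool (delta_record \<delta> y (Suc j)) :: real) \<longlonglongrightarrow> 0"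
    by (rule summable_LIMSEQ_zero)
  then have "eventually (\<lambda>j. of_bool (delta_record \<delta> y (Suc j)) < (1::real)) sequentially"
    by (rule order_tendstoD) simp
  then obtain J0 where J0: "\<And>j. J0 \<le> j \<Longrightarrow> \<not> delta_record \<delta> y (Suc j)"
    by (auto simp: eventually_sequentially)
  define J where "J = Suc J0"
  have J: "\<not> delta_record \<delta> y j" if "J \<le> j" for j
    using J0[of "j - 1"] that by (simp add: J_def)
  define C where "C = Max (y ` {..J})"
  have "y j \<le> C + \<bar>\<delta>\<bar> * real j" for j
  proof (induction j rule: less_induct)
    case (less j)
    show ?case
    proof (cases "j \<le> J \<or> j \<le> 1")
      case True
      then have "y j \<le> C" unfolding C_def by (intro Max_ge) (auto simp: J_def)
      then show ?thesis by (simp add: add_increasing2)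
    next
      case False
      then have "\<not> Max (y ` {1..j-1}) + \<delta> < y j" using J[of j] by (auto simp: delta_record_def)
      moreover have "Max (y ` {1..j-1}) \<in> y ` {1..j-1}" using False by (intro Max_in) auto
      then obtain i where i: "1 \<le> i" "i \<le> j - 1" "Max (y ` {1..j-1}) = y i" by auto
      ultimately have "y j \<le> y i + \<delta>" by simp
      also have "\<dots> \<le> C + \<bar>\<delta>\<bar> * real i + \<bar>\<delta>\<bar>" using less[of i] i False by (simp add: abs_ge_self add_mono)
      also have "\<dots> = C + \<bar>\<delta>\<bar> * real (Suc i)" by (simp add: algebra_simps)
      also have "\<dots> \<le> C + \<bar>\<delta>\<bar> * real j" using i False by (intro add_left_mono mult_left_mono) auto
      finally show ?thesis .
    qed
  qed
  then show ?thesis by blast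
qed

section \<open>Crossings of linear functions\<close>

context iid_sequence
begin

text \<open>The divergent half of the Borel-Cantelli lemma, done by hand: by independence the
  probability of no crossing after time \<open>m\<close> is at most \<open>exp\<close> of minus a
  partial tail sum, and these sums are unbounded.\<close>

lemma AE_frequently_above_linear:
  assumes inf: "(\<integral>\<^sup>+x. ennreal x \<partial>D) = \<infinity>" and K: "0 < K"
  shows "AE \<omega> in M. \<forall>m. \<exists>n>m. K * real n < X n \<omega>"
proof (subst AE_all_countable, intro allI)
  fix m
  define B where "B = {\<omega> \<in> space M. \<forall>k. X (m + Suc k) \<omega> \<le> K * real (m + Suc k)}"
  have [measurable]: "X (m + Suc k) \<in> borel_measurable M" for k by (rule measurable_X) simp
  have [measurable]: "B \<in> events" unfolding B_def by measurable
  define t where "t k = measure D {K * real m + K * real (Suc k)<..}" for k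
  have bound: "prob B \<le> exp (- (\<Sum>k<n. t k))" for n
  proof (cases "n = 0")
    case False
    let ?J = "(\<lambda>k. m + Suc k) ` {..<n}"
    have "prob B \<le> prob (\<Inter>j\<in>?J. X j -` {..K * real j} \<inter> space M)"
      using False by (intro finite_measure_mono sets.finite_INT) (auto simp: B_def)
    also have "\<dots> = (\<Prod>j\<in>?J. prob (X j -` {..K * real j} \<inter> space M))"
      using False by (intro indep_varsD[OF indep]) auto
    also have "\<dots> = (\<Prod>k<n. measure D {..K * real (m + Suc k)})"
      by (subst prod.reindex) (auto simp: inj_on_def prob_X)
    also have "\<dots> \<le> (\<Prod>k<n. exp (- t k))"
    proof (intro prod_mono conjI)
      fix k
      have "measure D {..K * real (m + Suc k)} = 1 - measure D (space D - {..K * real (m + Suc k)})"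
        by (subst D.prob_compl) auto
      also have "space D - {..K * real (m + Suc k)} = {K * real m + K * real (Suc k)<..}"
        by (auto simp: algebra_simps)
      finally show "measure D {..K * real (m + Suc k)} \<le> exp (- t k)"
        using exp_ge_add_one_self[of "- t k"] by (simp add: t_def)
    qed simp
    finally show ?thesis by (simp add: exp_sum[symmetric] sum_negf)
  qed simp
  have "prob B = 0"
  proof (rule ccontr)
    assume "prob B \<noteq> 0"
    then have pos: "0 < prob B" by (simp add: zero_less_measure_iff)
    have "(\<Sum>k. ennreal (t k)) \<le> ennreal (- ln (prob B))"
    proof (rule suminf_le_const)
      fix n
      have "ln (prob B) \<le> - (\<Sum>k<n. t k)"
        using ln_mono[OF bound[of n] pos] by simp
      then show "(\<Sum>k<n. ennreal (t k)) \<le> ennreal (- ln (prob B))"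
        by (subst sum_ennreal) (auto simp: t_def intro!: ennreal_leI)
    qed auto
    also have "\<dots> < \<infinity>" by simp
    finally show False
      using D.tail_sum_finite_iff[OF K, of "K * real m"] inf by (simp add: t_def D.emeasure_eq_measure)
  qed
  then have "AE \<omega> in M. \<omega> \<notin> B" by (subst (asm) prob_eq_0) auto
  then show "AE \<omega> in M. \<exists>n>m. K * real n < X n \<omega>"
  proof (rule AE_mp, intro AE_I2 impI)
    fix \<omega> assume "\<omega> \<in> space M" "\<omega> \<notin> B"
    then obtain k where "K * real (m + Suc k) < X (m + Suc k) \<omega>" by (auto simp: B_def not_le)
    then show "\<exists>n>m. K * real n < X n \<omega>" by (intro exI[of _ "m + Suc k"]) simp
  qed
qed

lemma record_prob_sum_infinite:
  assumes inf: "(\<integral>\<^sup>+x. ennreal x \<partial>D) = \<infinity>"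
  shows "(\<Sum>k. record_prob D c \<delta> k) = \<infinity>"
proof (rule ccontr)
  assume "\<not> ?thesis"
  then have "AE \<omega> in M. total_delta_records \<delta> (linear_drift X c \<omega>) < \<infinity>"
    using AE_finite_iff_record_prob[of \<delta> c] by (simp add: less_top)
  \<comment> \<open>In the slope, \<open>\<bar>\<delta>\<bar>\<close> beats the growth bound,
    \<open>\<bar>c\<bar>\<close> absorbs the drift, and the extra \<open>1\<close> beats the
    constant \<open>C\<close> once \<open>n > C\<close>.\<close>
  moreover have "AE \<omega> in M. \<forall>m. \<exists>n>m. (\<bar>\<delta>\<bar> + \<bar>c\<bar> + 1) * real n < X n \<omega>"
    by (rule AE_frequently_above_linear[OF inf]) (simp add: add_nonneg_pos)
  ultimately have "AE \<omega> in M. False"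
  proof eventually_elim
    case (elim \<omega>)
    obtain C where C: "\<And>j. 1 \<le> j \<Longrightarrow> linear_drift X c \<omega> j \<le> C + \<bar>\<delta>\<bar> * real j"
      using total_delta_records_finite_imp_linear_growth[OF elim(1)] by blast
    obtain n where n: "nat \<lceil>C\<rceil> < n" "(\<bar>\<delta>\<bar> + \<bar>c\<bar> + 1) * real n < X n \<omega>" using elim(2) by blast
    have "C < real n" using n(1) by linarith
    moreover have "- c * real n \<le> \<bar>c\<bar> * real n" by (intro mult_right_mono) auto
    ultimately show False
      using C[of n] n by (simp add: linear_drift_def algebra_simps)
  qed
  then show False by (simp add: AE_False)
qed

end

subsection \<open>Non-zero drift with finite mean of the positive part\<close>

text \<open>Weierstrass's product inequality. For infinite \<open>I\<close> the default values make
  both sides 1.\<close>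

lemma one_minus_sum_le_prod:
  fixes t :: "'b \<Rightarrow> real"
  assumes "\<And>i. i \<in> I \<Longrightarrow> 0 \<le> t i \<and> t i \<le> 1"
  shows "1 - sum t I \<le> (\<Prod>i\<in>I. 1 - t i)"
proof (cases "finite I")
  case True
  then show ?thesis using assms
  proof (induction I rule: finite_induct)
    case (insert j I)
    have p: "0 \<le> (\<Prod>i\<in>I. 1 - t i)" "(\<Prod>i\<in>I. 1 - t i) \<le> 1"
      using insert.prems by (auto intro!: prod_nonneg prod_le_1)
    have "1 - sum t (insert j I) \<le> (\<Prod>i\<in>I. 1 - t i) - t j"
      using insert by auto
    also have "\<dots> \<le> (\<Prod>i\<in>I. 1 - t i) - t j * (\<Prod>i\<in>I. 1 - t i)"
      using p insert.prems by (auto intro!: mult_left_le)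
    finally show ?case using insert by (simp add: algebra_simps)
  qed simp
qed simp

context real_distribution
begin

lemma measure_lessThan_mono: "x \<le> y \<Longrightarrow> measure M {..<x} \<le> measure M {..<y}"
  by (intro finite_measure_mono) auto

lemma record_prob_eq:
  "record_prob M c \<delta> k = (\<integral>\<^sup>+x. ennreal (\<Prod>i\<in>{1..k}. measure M {..<x + c * real i - \<delta>}) \<partial>M)"
  by (simp add: record_prob_def prod_ennreal)

lemma record_prob_Suc_le: "record_prob M c \<delta> (Suc k) \<le> record_prob M c \<delta> k"
  unfolding record_prob_eq
  by (intro nn_integral_mono ennreal_leI) (auto simp: prod.cl_ivl_Suc intro!: mult_right_le_one_le prod_nonneg)

text \<open>Either \<open>x\<close> is so large that a tail probability pays for it, or the later
  half of the \<open>2 * m\<close> factors are all evaluated at points not above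
  \<open>a\<close>.\<close>

lemma record_prob_negative_drift_le:
  assumes d: "0 < d"
  shows "record_prob M (- d) \<delta> (2 * m)
    \<le> ennreal (measure M {..<a} ^ m) + emeasure M {a + \<delta> - d + d * real (Suc m)<..}"
proof -
  \<comment> \<open>If \<open>x \<le> ?b\<close> and \<open>i > m\<close>, then
    \<open>x - d * i - \<delta> \<le> a\<close>. The multiple \<open>d * real (Suc m)\<close> gives
    the tails the form required by \<open>tail_sum_finite_iff\<close>.\<close>
  let ?b = "a + \<delta> - d + d * real (Suc m)"
  have "record_prob M (- d) \<delta> (2 * m)
      \<le> (\<integral>\<^sup>+x. ennreal (measure M {..<a} ^ m) + indicator {?b<..} x \<partial>M)"
    unfolding record_prob_eq
  proof (intro nn_integral_mono)
    fix x
    let ?p = "\<Prod>i\<in>{1..2 * m}. measure M {..<x + - d * real i - \<delta>}"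
    show "ennreal ?p \<le> ennreal (measure M {..<a} ^ m) + indicator {?b<..} x"
    proof (cases "?b < x")
      case True
      have "ennreal ?p \<le> 1" by (auto intro!: prod_le_1)
      also have "\<dots> \<le> ennreal (measure M {..<a} ^ m) + indicator {?b<..} x"
        using True by (simp add: add_increasing)
      finally show ?thesis .
    next
      case False
      have "?p \<le> (\<Prod>i\<in>{1..2 * m}. if m < i then measure M {..<a} else 1)"
      proof (intro prod_mono conjI)
        fix i
        have "x + - d * real i - \<delta> \<le> a" if "m < i"
        proof -
          have "d * real (Suc m) \<le> d * real i" using that d by (intro mult_left_mono) auto
          then show ?thesis using False d by (simp add: algebra_simps)
        qed
        then show "measure M {..<x + - d * real i - \<delta>} \<le> (if m < i then measure M {..<a} else 1)"
          by (auto intro: measure_lessThan_mono)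
      qed simp
      also have "\<dots> = (\<Prod>i\<in>{Suc m..2 * m}. measure M {..<a})"
        by (rule prod.mono_neutral_cong_right) auto
      also have "\<dots> = measure M {..<a} ^ m" by simp
      finally show ?thesis by (auto intro!: ennreal_leI add_increasing2)
    qed
  qed
  also have "\<dots> = ennreal (measure M {..<a} ^ m) + emeasure M {?b<..}"
    by (simp add: nn_integral_add emeasure_space_1[simplified])
  finally show ?thesis .
qed

text \<open>Fixing \<open>a\<close> so far left that less than full mass lies below it, the
  even-indexed bounds split into a geometric series and a convergent tail series.\<close>

lemma record_prob_sum_finite_negative_drift:
  assumes c: "c < 0" and fin: "(\<integral>\<^sup>+x. ennreal x \<partial>M) < \<infinity>"
  shows "(\<Sum>k. record_prob M c \<delta> k) < \<infinity>"
proof -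
  define d where "d = - c"
  have d: "0 < d" "c = - d" using c by (auto simp: d_def)
  have "eventually (\<lambda>a. cdf M a < 1) at_bot"
    by (rule order_tendstoD(2)[OF cdf_lim_at_bot]) simp
  then obtain a where "cdf M a < 1" by (auto simp: eventually_at_bot_linorder)
  moreover have "measure M {..<a} \<le> cdf M a"
    unfolding cdf_def by (intro finite_measure_mono) auto
  ultimately have a: "measure M {..<a} < 1" by simp
  define S where "S = (\<Sum>m. ennreal (measure M {..<a} ^ m))
      + (\<Sum>m. emeasure M {a + \<delta> - d + d * real (Suc m)<..})"
  have "(\<Sum>m. ennreal (measure M {..<a} ^ m)) < \<infinity>"
    using a by (subst suminf_ennreal2) (auto intro!: summable_geometric)
  then have S: "S < \<infinity>"
    using tail_sum_finite_iff[OF d(1), of "a + \<delta> - d"] fin by (simp add: S_def)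
  have "(\<Sum>k. record_prob M c \<delta> k) \<le> 2 * S"
  proof (rule suminf_le_const)
    fix n
    have "(\<Sum>k<n. record_prob M c \<delta> k) \<le> (\<Sum>k<2 * n. record_prob M c \<delta> k)"
      by (intro sum_mono2) auto
    \<comment> \<open>Monotonicity in the index bounds each odd term by the even term before
      it.\<close>
    also have "\<dots> \<le> (\<Sum>m<n. 2 * record_prob M c \<delta> (2 * m))"
    proof (induction n)
      case (Suc n)
      have "(\<Sum>k<2 * Suc n. record_prob M c \<delta> k)
          = (\<Sum>k<2 * n. record_prob M c \<delta> k) + (record_prob M c \<delta> (2 * n) + record_prob M c \<delta> (Suc (2 * n)))"
        by (simp add: ac_simps)
      also have "\<dots> \<le> (\<Sum>m<n. 2 * record_prob M c \<delta> (2 * m)) + (record_prob M c \<delta> (2 * n) + record_prob M c \<delta> (2 * n))"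
        by (intro add_mono Suc order_refl record_prob_Suc_le)
      finally show ?case by (simp add: mult_2)
    qed simp
    also have "\<dots> \<le> (\<Sum>m<n. 2 * (ennreal (measure M {..<a} ^ m) + emeasure M {a + \<delta> - d + d * real (Suc m)<..}))"
      unfolding d(2) by (intro sum_mono mult_left_mono record_prob_negative_drift_le d) auto
    also have "\<dots> = 2 * ((\<Sum>m<n. ennreal (measure M {..<a} ^ m)) + (\<Sum>m<n. emeasure M {a + \<delta> - d + d * real (Suc m)<..}))"
      by (simp only: sum_distrib_left[symmetric] sum.distrib)
    also have "\<dots> \<le> 2 * S"
      unfolding S_def by (intro mult_left_mono add_mono sum_le_suminf) auto
    finally show "(\<Sum>k<n. record_prob M c \<delta> k) \<le> 2 * S" .
  qed auto
  also have "2 * S < \<infinity>" using S by (simp add: ennreal_mult_less_top)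
  finally show ?thesis .
qed

text \<open>On the event above \<open>x0\<close>, every product is at least the corresponding
  product of the \<open>g i\<close>. These factors are positive and approach 1 with summable
  defects, so their products, and hence the record probabilities, stay away from 0.\<close>

lemma record_prob_sum_infinite_positive_drift:
  assumes c: "0 < c" and fin: "(\<integral>\<^sup>+x. ennreal x \<partial>M) < \<infinity>"
    and x0: "0 < measure M {x0<..}" "0 < measure M {..<x0 + c - \<delta>}"
  shows "(\<Sum>k. record_prob M c \<delta> k) = \<infinity>"
proof -
  define g where "g i = measure M {..<x0 + c * real i - \<delta>}" for i
  \<comment> \<open>The shift by \<open>1\<close> puts the closed half-line complementary to this
    tail inside the open half-line defining \<open>g (Suc k)\<close>.\<close>
  define t where "t k = measure M {x0 - \<delta> - 1 + c * real (Suc k)<..}" for k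
  have g: "1 - t k \<le> g (Suc k)" for k
  proof -
    have "1 - t k = measure M (space M - {x0 - \<delta> - 1 + c * real (Suc k)<..})"
      unfolding t_def by (subst prob_compl) auto
    also have "\<dots> \<le> g (Suc k)"
      unfolding g_def by (intro finite_measure_mono) (auto simp: algebra_simps)
    finally show ?thesis .
  qed
  have gpos: "0 < g i" if "1 \<le> i" for i
  proof -
    have "c * 1 \<le> c * real i" using that c by (intro mult_left_mono) auto
    then have "measure M {..<x0 + c - \<delta>} \<le> g i"
      unfolding g_def by (intro measure_lessThan_mono) simp
    then show ?thesis using x0 by simp
  qed
  have "summable t"
    using tail_sum_finite_iff[OF c, of "x0 - \<delta> - 1"] fin
    by (intro summable_suminf_not_top) (auto simp: t_def emeasure_eq_measure)
  then obtain m where "\<forall>n\<ge>m. norm (\<Sum>k. t (k + n)) < 1 / 2"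
    using suminf_exist_split[of "1/2" t] by auto
  then have m: "(\<Sum>k. t (k + m)) < 1 / 2" by (metis abs_le_D1 le_less_trans order_refl real_norm_def)
  have tail: "(\<Sum>k<n. t (k + m)) < 1 / 2" for n
  proof -
    have "(\<Sum>k<n. t (k + m)) \<le> (\<Sum>k. t (k + m))"
      by (intro sum_le_suminf summable_ignore_initial_segment \<open>summable t\<close>) (auto simp: t_def)
    with m show ?thesis by simp
  qed
  \<comment> \<open>The first \<open>m\<close> factors are merely positive; all later ones together
    contribute at least \<open>1 / 2\<close>, because their defects sum to less than
    \<open>1 / 2\<close>.\<close>
  define q where "q = (\<Prod>k<m. g (Suc k)) / 2"
  have q: "0 < q" unfolding q_def using gpos by (auto intro!: prod_pos)
  have prod: "q \<le> (\<Prod>k<n. g (Suc k))" for n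
  proof -
    have "1 / 2 \<le> 1 - (\<Sum>k<n. t (k + m))" using tail[of n] by simp
    also have "\<dots> \<le> (\<Prod>k<n. 1 - t (k + m))"
      by (rule one_minus_sum_le_prod) (simp add: t_def)
    also have "\<dots> \<le> (\<Prod>k<n. g (Suc (k + m)))"
      by (intro prod_mono conjI g) (simp add: t_def)
    finally have "(\<Prod>k<m. g (Suc k)) * (1 / 2) \<le> (\<Prod>k<m. g (Suc k)) * (\<Prod>k<n. g (Suc (k + m)))"
      by (rule mult_left_mono) (simp add: prod_nonneg g_def)
    then have "q \<le> (\<Prod>k<m. g (Suc k)) * (\<Prod>k<n. g (Suc (k + m)))"
      by (simp add: q_def)
    also have "\<dots> = (\<Prod>k<n + m. g (Suc k))"
      by (induction n) (simp_all add: mult.assoc[symmetric])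
    \<comment> \<open>All factors are at most 1, so removing \<open>m\<close> of them cannot
      decrease the product.\<close>
    also have "\<dots> \<le> (\<Prod>k<n. g (Suc k))"
    proof (induction m)
      case (Suc m)
      have "(\<Prod>k<n + Suc m. g (Suc k)) \<le> (\<Prod>k<n + m. g (Suc k))"
        by (simp add: mult_left_le prod_nonneg g_def)
      with Suc show ?case by simp
    qed simp
    finally show ?thesis .
  qed
  have low: "ennreal (q * measure M {x0<..}) \<le> record_prob M c \<delta> k" for k
  proof -
    have "ennreal (q * measure M {x0<..}) = (\<integral>\<^sup>+x. ennreal q * indicator {x0<..} x \<partial>M)"
      using q by (subst nn_integral_cmult_indicator) (auto simp: ennreal_mult emeasure_eq_measure)
    also have "\<dots> \<le> record_prob M c \<delta> k"
      unfolding record_prob_eq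
    proof (intro nn_integral_mono)
      fix x
      have "q \<le> (\<Prod>i\<in>{1..k}. measure M {..<x + c * real i - \<delta>})" if "x0 < x"
      proof -
        have "q \<le> (\<Prod>i\<in>{1..k}. g i)"
          using prod[of k] by (simp add: prod.atLeast1_atMost_eq)
        also have "\<dots> \<le> (\<Prod>i\<in>{1..k}. measure M {..<x + c * real i - \<delta>})"
          unfolding g_def using that by (intro prod_mono conjI measure_lessThan_mono) auto
        finally show ?thesis .
      qed
      then show "ennreal q * indicator {x0<..} x \<le> ennreal (\<Prod>i\<in>{1..k}. measure M {..<x + c * real i - \<delta>})"
        by (auto simp: indicator_def intro!: ennreal_leI)
    qed
    finally show ?thesis .
  qed
  have "\<infinity> = (\<Sum>k::nat. ennreal (q * measure M {x0<..}))"
    using q x0 by (simp add: summable_iff_suminf_neq_top summable_const_iff)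
  also have "\<dots> \<le> (\<Sum>k. record_prob M c \<delta> k)"
    by (intro suminf_le low) auto
  finally show ?thesis by (simp add: top_unique)
qed

end

subsection \<open>Zero drift\<close>

locale continuous_distribution = real_distribution +
  assumes continuous_cdf: "measure M {x} = 0"
begin

section \<open>Continuity of the distribution function and the probability integral
  transform\<close>

lemma isCont_cdf_all: "isCont (cdf M) x"
  by (simp add: isCont_cdf continuous_cdf)

lemma borel_measurable_cdf [measurable]: "cdf M \<in> borel_measurable borel"
  by (intro borel_measurable_mono monoI cdf_nondecreasing)

lemma measure_lessThan: "measure M {..<x} = cdf M x"
proof -
  have "{..x} = {..<x} \<union> {x}" by auto
  then have "cdf M x = measure M ({..<x} \<union> {x})" by (simp only: cdf_def)
  also have "\<dots> = measure M {..<x}" by (subst finite_measure_Union) (auto simp: continuous_cdf)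
  finally show ?thesis by simp
qed

lemma measure_greaterThan: "measure M {x<..} = 1 - cdf M x"
proof -
  have "measure M {x<..} = 1 - measure M (space M - {x<..})" by (subst prob_compl) auto
  also have "space M - {x<..} = {..x}" by auto
  finally show ?thesis by (simp add: cdf_def)
qed

text \<open>By continuity a nonempty sublevel set is a closed half-line whose right end
  \<open>s\<close> satisfies \<open>cdf M s = u\<close>. An empty one forces
  \<open>u = 0\<close>.\<close>

lemma measure_cdf_le:
  assumes "0 \<le> u" "u < 1"
  shows "measure M {x. cdf M x \<le> u} = u"
proof (cases "{x. cdf M x \<le> u} = {}")
  case True
  have "u \<le> 0"
  proof (rule ccontr)
    assume "\<not> u \<le> 0"
    then have "eventually (\<lambda>x. cdf M x < u) at_bot"
      by (intro order_tendstoD(2)[OF cdf_lim_at_bot]) simp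
    then obtain x where "cdf M x < u" by (auto simp: eventually_at_bot_linorder)
    with True show False by (auto simp: set_eq_iff intro: less_imp_le)
  qed
  with True assms show ?thesis by simp
next
  case False
  let ?A = "{x. cdf M x \<le> u}"
  have "eventually (\<lambda>x. u < cdf M x) at_top"
    by (rule order_tendstoD(1)[OF cdf_lim_at_top_prob]) (use assms in simp)
  then obtain b where b: "u < cdf M b" by (auto simp: eventually_at_top_linorder)
  have ub: "x \<le> b" if "x \<in> ?A" for x
    using cdf_nondecreasing[of b x] that b by (cases "x \<le> b") auto
  then have bdd: "bdd_above ?A" by (rule bdd_aboveI)
  have "closed ?A"
    by (intro closed_Collect_le continuous_on_const) (simp add: continuous_at_imp_continuous_on isCont_cdf_all)
  define s where "s = Sup ?A"
  have s: "s \<in> ?A" unfolding s_def by (rule closed_contains_Sup[OF False bdd \<open>closed ?A\<close>])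
  have "\<exists>x\<ge>s. x \<le> b \<and> cdf M x = u"
    using s b ub[OF s] by (intro IVT) (auto simp: isCont_cdf_all)
  then obtain x where x: "s \<le> x" "cdf M x = u" by blast
  then have "x \<le> s" unfolding s_def by (intro cSup_upper bdd) simp
  with x have "cdf M s = u" by simp
  have "?A = {..s}"
    using s cSup_upper[OF _ bdd] cdf_nondecreasing[of _ s] by (fastforce simp: s_def[symmetric])
  then show ?thesis using \<open>cdf M s = u\<close> by (simp add: cdf_def)
qed

text \<open>The probability integral transform: the two laws have the same distribution function,
  \<open>u\<close> clipped to the unit interval.\<close>

lemma distr_cdf: "distr M borel (cdf M) = density lborel (indicator {0..1})"
proof -
  let ?U = "density lborel (indicator {0..1::real})"
  have U: "emeasure ?U A = emeasure lborel ({0..1} \<inter> A)" if "A \<in> sets borel" for A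
    using that by (simp add: emeasure_density nn_integral_indicator flip: indicator_inter_arith)
  have rdU: "real_distribution ?U"
    by (intro real_distribution.intro prob_spaceI real_distribution_axioms.intro) (auto simp: U)
  have rdF: "real_distribution (distr M borel (cdf M))"
    by (intro real_distribution_distr) (simp only: measurable_cong_sets[OF events_eq_borel refl] borel_measurable_cdf)
  show ?thesis
  proof (rule cdf_unique[OF rdF rdU], rule ext)
    fix u
    have "cdf (distr M borel (cdf M)) u = measure M {x. cdf M x \<le> u}"
      unfolding cdf_def[of "distr M borel (cdf M)"]
      by (subst measure_distr) (auto simp: vimage_def)
    also have "\<dots> = max 0 (min 1 u)"
    proof -
      consider "u < 0" | "0 \<le> u" "u < 1" | "1 \<le> u" by linarith
      then show ?thesis
      proof cases
        case 1
        then have "{x. cdf M x \<le> u} = {}" using cdf_nonneg order_trans by fastforce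
        then show ?thesis using 1 by simp
      next
        case 2
        then show ?thesis by (simp add: measure_cdf_le)
      next
        case 3
        then have "{x. cdf M x \<le> u} = space M" using cdf_bounded_prob order_trans by fastforce
        then show ?thesis using 3 prob_space by simp
      qed
    qed
    also have "\<dots> = measure lborel {0..min 1 u}" by simp
    also have "{0..min 1 u} = {0..1} \<inter> {..u}" by auto
    also have "measure lborel ({0..1} \<inter> {..u}) = cdf ?U u"
      unfolding cdf_def measure_def by (simp add: U)
    finally show "cdf (distr M borel (cdf M)) u = cdf ?U u" .
  qed
qed

lemma nn_integral_cdf:
  assumes [measurable]: "h \<in> borel_measurable borel"
  shows "(\<integral>\<^sup>+x. h (cdf M x) \<partial>M) = (\<integral>\<^sup>+u. h u * indicator {0..1} u \<partial>lborel)"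
proof -
  have "(\<integral>\<^sup>+x. h (cdf M x) \<partial>M) = (\<integral>\<^sup>+u. h u \<partial>distr M borel (cdf M))"
    by (subst nn_integral_distr) auto
  also have "\<dots> = (\<integral>\<^sup>+u. h u * indicator {0..1} u \<partial>lborel)"
    unfolding distr_cdf by (subst nn_integral_density) (auto simp: mult.commute)
  finally show ?thesis .
qed

lemma AE_cdf_less_1: "AE x in M. cdf M x < 1"
proof -
  have "(\<integral>\<^sup>+x. indicator {1..} (cdf M x) \<partial>M) = (\<integral>\<^sup>+u. indicator {1::real} u \<partial>lborel)"
    by (subst nn_integral_cdf, simp, rule nn_integral_cong) (auto simp: indicator_def)
  also have "\<dots> = 0" by simp
  finally have "AE x in M. indicator {1..} (cdf M x) = (0 :: ennreal)"
    by (subst (asm) nn_integral_0_iff_AE) auto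
  then show ?thesis by eventually_elim (auto simp: indicator_def split: if_splits)
qed

section \<open>Record series without drift\<close>

lemma record_prob_zero_drift: "record_prob M 0 \<delta> k = (\<integral>\<^sup>+x. ennreal (cdf M (x - \<delta>) ^ k) \<partial>M)"
  by (simp add: record_prob_eq measure_lessThan)

text \<open>For \<open>\<delta> \<le> 0\<close> there are at least as many records as for
  \<open>\<delta> = 0\<close>, where the transform gives the terms of the harmonic series.\<close>

lemma record_prob_sum_infinite_zero_drift:
  assumes "\<delta> \<le> 0"
  shows "(\<Sum>k. record_prob M 0 \<delta> k) = \<infinity>"
proof -
  have "ennreal (1 / real (Suc k)) \<le> record_prob M 0 \<delta> k" for k
  proof -
    have "((\<lambda>u. u ^ Suc k / real (Suc k)) has_real_derivative x ^ k) (at x)" for x :: real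
      by (auto intro!: derivative_eq_intros simp del: power_Suc of_nat_Suc)
    then have "ennreal (1 / real (Suc k)) = (\<integral>\<^sup>+u. ennreal (u ^ k) * indicator {0..1} u \<partial>lborel)"
      by (subst nn_integral_FTC_Icc[where F="\<lambda>u. u ^ Suc k / real (Suc k)"])
        (auto intro: has_field_derivative_at_within)
    also have "\<dots> = (\<integral>\<^sup>+x. ennreal (cdf M x ^ k) \<partial>M)"
      by (subst nn_integral_cdf) auto
    also have "\<dots> \<le> record_prob M 0 \<delta> k"
      unfolding record_prob_zero_drift using assms
      by (intro nn_integral_mono ennreal_leI power_mono cdf_nondecreasing) (auto simp: cdf_nonneg)
    finally show ?thesis .
  qed
  then have "(\<Sum>k. ennreal (1 / real (Suc k))) \<le> (\<Sum>k. record_prob M 0 \<delta> k)"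
    by (intro suminf_le) auto
  moreover have "\<not> summable (\<lambda>k. 1 / real (Suc k))"
    using not_summable_harmonic[where 'a=real]
      summable_Suc_iff[of "\<lambda>k. inverse (real k)"] by (simp add: inverse_eq_divide)
  then have "(\<Sum>k. ennreal (1 / real (Suc k))) = top"
    by (intro summable_iff_suminf_neq_top) auto
  ultimately show ?thesis by (simp add: top_unique)
qed

text \<open>This is \<open>1 / (1 - v) = 1 + \<integral> du / (1 - u)\<^sup>2\<close> over
  \<open>0 \<le> u \<le> v\<close>, pulled back along the distribution function with
  \<open>v = cdf M t\<close>.\<close>

lemma nn_integral_below_eq:
  assumes "cdf M t < 1"
  shows "ennreal (1 / (1 - cdf M t)) = 1 + (\<integral>\<^sup>+x. ennreal (1 / (1 - cdf M x)\<^sup>2) * indicator {..<t} x \<partial>M)"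
proof -
  define v where "v = cdf M t"
  have v: "0 \<le> v" "v < 1" using assms cdf_nonneg by (auto simp: v_def)
  \<comment> \<open>The distribution function may be constant to the right of \<open>t\<close>, but
    such a flat stretch carries no mass.\<close>
  have null: "emeasure M ({x. cdf M x \<le> v} - {..<t}) = 0"
  proof -
    have "measure M ({x. cdf M x \<le> v} - {..<t}) = measure M {x. cdf M x \<le> v} - measure M {..<t}"
      by (rule finite_measure_Diff) (auto simp: v_def intro: cdf_nondecreasing)
    also have "\<dots> = 0" using measure_cdf_le[OF v] measure_lessThan[of t] by (simp add: v_def)
    finally show ?thesis by (simp add: emeasure_eq_measure)
  qed
  have "AE x in M. x \<notin> {x. cdf M x \<le> v} - {..<t}"
    by (rule AE_not_in) (use null in \<open>auto simp: null_sets_def\<close>)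
  then have "AE x in M. indicator {..<t} x = (indicator {..v} (cdf M x) :: ennreal)"
    by eventually_elim (auto simp: indicator_def v_def cdf_nondecreasing)
  then have "(\<integral>\<^sup>+x. ennreal (1 / (1 - cdf M x)\<^sup>2) * indicator {..<t} x \<partial>M)
      = (\<integral>\<^sup>+x. ennreal (1 / (1 - cdf M x)\<^sup>2) * indicator {..v} (cdf M x) \<partial>M)"
    by (intro nn_integral_cong_AE) auto
  also have "\<dots> = (\<integral>\<^sup>+u. ennreal (1 / (1 - u)\<^sup>2) * indicator {0..v} u \<partial>lborel)"
    using v by (subst nn_integral_cdf) (auto intro!: nn_integral_cong simp: indicator_def)
  also have "\<dots> = ennreal (1 / (1 - v) - 1 / (1 - 0))"
    using v by (intro nn_integral_FTC_Icc)
      (auto intro!: derivative_eq_intros simp: power2_eq_square divide_simps)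
  finally show ?thesis using v
    by (simp add: v_def field_simps flip: ennreal_1 ennreal_plus)
qed

text \<open>Summing the geometric series gives \<open>1 / (1 - cdf M (y - \<delta>))\<close>.
  Writing this as an integral over \<open>x < y - \<delta>\<close> and exchanging the order leaves
  the tail beyond \<open>x + \<delta>\<close> as inner integral.\<close>

lemma record_prob_sum_zero_drift:
  assumes \<delta>: "0 < \<delta>"
  shows "(\<Sum>k. record_prob M 0 \<delta> k)
    = 1 + (\<integral>\<^sup>+x. ennreal ((1 - cdf M (x + \<delta>)) / (1 - cdf M x)\<^sup>2) \<partial>M)"
proof -
  interpret P: pair_sigma_finite M M ..
  define h where "h x = ennreal (1 / (1 - cdf M x)\<^sup>2)" for x
  have [measurable]: "h \<in> borel_measurable borel" unfolding h_def by measurable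
  have "(\<Sum>k. record_prob M 0 \<delta> k) = (\<integral>\<^sup>+y. (\<Sum>k. ennreal (cdf M (y - \<delta>) ^ k)) \<partial>M)"
    unfolding record_prob_zero_drift by (subst nn_integral_suminf) auto
  also have "\<dots> = (\<integral>\<^sup>+y. 1 + (\<integral>\<^sup>+x. h x * indicator {..<y - \<delta>} x \<partial>M) \<partial>M)"
  proof (rule nn_integral_cong_AE)
    show "AE y in M. (\<Sum>k. ennreal (cdf M (y - \<delta>) ^ k)) = 1 + (\<integral>\<^sup>+x. h x * indicator {..<y - \<delta>} x \<partial>M)"
      using AE_cdf_less_1
    proof eventually_elim
      case (elim y)
      have "cdf M (y - \<delta>) < 1"
        using elim cdf_nondecreasing[of "y - \<delta>" y] \<delta> by simp
      moreover from this have "(\<Sum>k. ennreal (cdf M (y - \<delta>) ^ k)) = ennreal (1 / (1 - cdf M (y - \<delta>)))"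
        using cdf_nonneg[of "y - \<delta>"]
        by (intro suminf_ennreal_eq geometric_sums) auto
      ultimately show ?case by (simp add: nn_integral_below_eq h_def)
    qed
  qed
  also have "\<dots> = 1 + (\<integral>\<^sup>+y. (\<integral>\<^sup>+x. h x * indicator {..<y - \<delta>} x \<partial>M) \<partial>M)"
  proof -
    have [measurable]: "(\<lambda>y. \<integral>\<^sup>+x. h x * indicator {..<y - \<delta>} x \<partial>M) \<in> borel_measurable M"
      by (intro borel_measurable_nn_integral) (simp add: indicator_def)
    show ?thesis by (subst nn_integral_add) (auto simp: emeasure_space_1[simplified])
  qed
  also have "(\<integral>\<^sup>+y. (\<integral>\<^sup>+x. h x * indicator {..<y - \<delta>} x \<partial>M) \<partial>M)
      = (\<integral>\<^sup>+x. (\<integral>\<^sup>+y. h x * indicator {..<y - \<delta>} x \<partial>M) \<partial>M)"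
    by (rule P.Fubini') (simp add: indicator_def)
  also have "\<dots> = (\<integral>\<^sup>+x. ennreal ((1 - cdf M (x + \<delta>)) / (1 - cdf M x)\<^sup>2) \<partial>M)"
  proof (rule nn_integral_cong)
    fix x
    have "(\<integral>\<^sup>+y. h x * indicator {..<y - \<delta>} x \<partial>M) = (\<integral>\<^sup>+y. h x * indicator {x + \<delta><..} y \<partial>M)"
      by (intro nn_integral_cong) (auto simp: indicator_def)
    also have "\<dots> = h x * emeasure M {x + \<delta><..}"
      by (subst nn_integral_cmult_indicator) auto
    also have "\<dots> = ennreal ((1 - cdf M (x + \<delta>)) / (1 - cdf M x)\<^sup>2)"
      by (simp add: h_def emeasure_eq_measure measure_greaterThan mult.commute cdf_bounded_prob flip: ennreal_mult)
    finally show "(\<integral>\<^sup>+y. h x * indicator {..<y - \<delta>} x \<partial>M)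
        = ennreal ((1 - cdf M (x + \<delta>)) / (1 - cdf M x)\<^sup>2)" .
  qed
  finally show ?thesis .
qed

text \<open>Only the half-line from 0 matters, because the integrand is bounded on the negative
  numbers: up to \<open>a\<close> its denominator stays away from 0, and between \<open>a\<close>
  and 0 its numerator vanishes.\<close>

lemma record_prob_sum_zero_drift_finite_iff:
  assumes \<delta>: "0 < \<delta>"
  shows "(\<Sum>k. record_prob M 0 \<delta> k) < \<infinity> \<longleftrightarrow>
    (\<integral>\<^sup>+x. ennreal ((1 - cdf M (x + \<delta>)) / (1 - cdf M x)\<^sup>2) * indicator {0..} x \<partial>M) < \<infinity>"
proof -
  define g where "g x = (1 - cdf M (x + \<delta>)) / (1 - cdf M x)\<^sup>2" for x
  have [measurable]: "g \<in> borel_measurable borel" unfolding g_def by measurable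
  obtain a where a: "cdf M a < 1" "\<And>x. a < x \<Longrightarrow> x < 0 \<Longrightarrow> cdf M (x + \<delta>) = 1"
  proof (cases "cdf M 0 < 1")
    case True
    then show ?thesis by (intro that[of 0]) auto
  next
    case False
    let ?A = "{x. cdf M x < 1}"
    have "eventually (\<lambda>x. cdf M x < 1) at_bot"
      by (rule order_tendstoD(2)[OF cdf_lim_at_bot]) simp
    then have ne: "?A \<noteq> {}" by (auto simp: eventually_at_bot_linorder)
    have "x \<le> 0" if "x \<in> ?A" for x
      using cdf_nondecreasing[of 0 x] that False by (cases "x \<le> 0") auto
    then have bdd: "bdd_above ?A" by (rule bdd_aboveI)
    obtain x where x: "Sup ?A - \<delta> / 2 < x" "cdf M x < 1"
      using less_cSup_iff[OF ne bdd, of "Sup ?A - \<delta> / 2"] \<delta> by auto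
    show ?thesis
    \<comment> \<open>Half of \<open>\<delta>\<close> keeps \<open>a\<close> below the right end of
      the distribution, while adding \<open>\<delta>\<close> to any point beyond \<open>a\<close>
      passes that end.\<close>
    proof (rule that[of "Sup ?A - \<delta> / 2"])
      show "cdf M (Sup ?A - \<delta> / 2) < 1"
        using x cdf_nondecreasing[of "Sup ?A - \<delta> / 2" x] by simp
      fix y assume "Sup ?A - \<delta> / 2 < y"
      then have "y + \<delta> \<notin> ?A" using cSup_upper[OF _ bdd, of "y + \<delta>"] \<delta> by auto
      then show "cdf M (y + \<delta>) = 1" using cdf_bounded_prob[of "y + \<delta>"] by simp
    qed
  qed
  have neg: "g x \<le> 1 / (1 - cdf M a)\<^sup>2" if "x < 0" for x
  proof (cases "a < x")
    case False
    then have "cdf M x \<le> cdf M a" by (intro cdf_nondecreasing) simp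
    then show ?thesis unfolding g_def using a(1) cdf_nonneg[of "x + \<delta>"] cdf_bounded_prob[of "x + \<delta>"]
      by (intro frac_le power_mono) auto
  qed (use a(2) that in \<open>simp add: g_def\<close>)
  have "(\<integral>\<^sup>+x. ennreal (g x) * indicator {..<0} x \<partial>M) \<le> (\<integral>\<^sup>+x. ennreal (1 / (1 - cdf M a)\<^sup>2) \<partial>M)"
    using neg by (intro nn_integral_mono) (auto simp: indicator_def intro!: ennreal_leI)
  also have "\<dots> < \<infinity>" by (simp add: emeasure_space_1[simplified])
  finally have fin: "(\<integral>\<^sup>+x. ennreal (g x) * indicator {..<0} x \<partial>M) < \<infinity>" .
  have "(\<integral>\<^sup>+x. ennreal (g x) \<partial>M)
      = (\<integral>\<^sup>+x. ennreal (g x) * indicator {..<0} x + ennreal (g x) * indicator {0..} x \<partial>M)"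
    by (intro nn_integral_cong) (auto simp: indicator_def)
  also have "\<dots> = (\<integral>\<^sup>+x. ennreal (g x) * indicator {..<0} x \<partial>M)
      + (\<integral>\<^sup>+x. ennreal (g x) * indicator {0..} x \<partial>M)"
    by (rule nn_integral_add) auto
  finally show ?thesis
    using record_prob_sum_zero_drift[OF \<delta>] fin by (simp add: g_def[symmetric])
qed

end

subsection \<open>Distributions with a density\<close>

lemma density_pos_of_interval:
  fixes f :: "real \<Rightarrow> real"
  assumes [measurable]: "f \<in> borel_measurable borel" "S \<in> sets borel"
    and ab: "a < b" "{a<..<b} \<subseteq> S" and pos: "\<And>x. a < x \<Longrightarrow> x < b \<Longrightarrow> 0 < f x"
  shows "emeasure (density lborel (\<lambda>x. ennreal (f x))) S \<noteq> 0"
proof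
  assume "emeasure (density lborel (\<lambda>x. ennreal (f x))) S = 0"
  then have "AE x in lborel. ennreal (f x) * indicator S x = 0"
    by (simp add: emeasure_density nn_integral_0_iff_AE)
  then have "AE x in lborel. x \<notin> {a<..<b}"
  proof eventually_elim
    case (elim x)
    show ?case
    proof
      assume "x \<in> {a<..<b}"
      then have "x \<in> S" "0 < f x" using ab pos by auto
      with elim show False by (simp add: ennreal_eq_0_iff)
    qed
  qed
  then have "emeasure lborel {a<..<b} = 0"
    by (subst (asm) AE_iff_measurable[where N="{a<..<b}"]) auto
  with ab show False by simp
qed

theorem theorem3:
  fixes M :: "'a measure"
    and X :: "nat \<Rightarrow> 'a \<Rightarrow> real"
    and f F :: "real \<Rightarrow> real"
    and x_minus x_plus :: ereal
    and c \<delta> :: real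
  assumes "prob_space M"
    and "prob_space.indep_vars M (\<lambda>_. borel) X {1..}"
    and "\<And>n. n \<ge> 1 \<Longrightarrow> distributed M lborel (X n) (\<lambda>x. ennreal (f x))"
    and "\<And>n. n \<ge> 1 \<Longrightarrow> F = cdf (distr M borel (X n))"
    and "x_minus < x_plus"
    and "\<And>x. x_minus < ereal x \<Longrightarrow> ereal x < x_plus \<Longrightarrow> f x > 0"
    and "\<And>x. \<not> (x_minus < ereal x \<and> ereal x < x_plus) \<Longrightarrow> f x = 0"
  defines "N \<equiv> \<lambda>\<omega>. total_delta_records \<delta> (linear_drift X c \<omega>)"
  shows "((AE \<omega> in M. N \<omega> < \<infinity>) \<longleftrightarrow>
           (c < 0 \<and> mu_plus f < \<infinity>) \<or>
           (c = 0 \<and> \<delta> > 0 \<and> record_integral \<delta> F f < \<infinity>) \<or>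
           (c > 0 \<and> x_plus - x_minus \<le> ereal (\<delta> - c))) \<and>
         ((AE \<omega> in M. N \<omega> < \<infinity>) \<longleftrightarrow> (\<integral>\<^sup>+\<omega>. N \<omega> \<partial>M) < \<infinity>)"
proof -
  define D where "D = distr M borel (X 1)"
  \<comment> \<open>The density assumption concerns \<open>ennreal (f x)\<close> only; nonnegativity
    is what recovers the measurability of \<open>f\<close> itself.\<close>
  have f0: "0 \<le> f x" for x
    using assms(6,7) by (cases "x_minus < ereal x \<and> ereal x < x_plus") (auto intro: less_imp_le)
  have "(\<lambda>x. ennreal (f x)) \<in> borel_measurable borel"
    using distributed_borel_measurable[OF assms(3)[of 1]] by simp
  then have f[measurable]: "f \<in> borel_measurable borel"
    using f0 by (subst (asm) borel_measurable_ennreal_iff) auto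
  have dens: "distr M borel (X n) = density lborel (\<lambda>x. ennreal (f x))" if "1 \<le> n" for n
    using distributed_distr_eq_density[OF assms(3)[OF that]] by (simp cong: distr_cong)
  have D: "D = density lborel (\<lambda>x. ennreal (f x))" unfolding D_def by (rule dens) simp
  interpret iid_sequence M X D
    using assms(1,2) by (intro iid_sequence.intro iid_sequence_axioms.intro) (auto simp: dens D)
  interpret C: continuous_distribution D
  proof
    fix x
    have "emeasure D {x} = (\<integral>\<^sup>+y. 0 \<partial>lborel)"
      unfolding D by (subst emeasure_density) (auto intro!: nn_integral_cong_AE eventually_mono[OF AE_lborel_singleton[of x]])
    then show "measure D {x} = 0" by (simp add: measure_def)
  qed
  have F: "F = cdf D" using assms(4)[of 1] by (simp add: D_def)
  have mu: "(\<integral>\<^sup>+x. ennreal x \<partial>D) = mu_plus f"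
    unfolding D mu_plus_def
    by (subst nn_integral_density) (auto intro!: nn_integral_cong simp: f0 indicator_def ennreal_neg mult.commute ennreal_mult)
  have rec: "(\<integral>\<^sup>+x. ennreal ((1 - cdf D (x + \<delta>)) / (1 - cdf D x)\<^sup>2) * indicator {0..} x \<partial>D)
      = record_integral \<delta> F f"
  proof -
    define G where "G x = (1 - cdf D (x + \<delta>)) / (1 - cdf D x)\<^sup>2" for x
    have [measurable]: "cdf D \<in> borel_measurable borel" by (rule C.borel_measurable_cdf)
    have [measurable]: "G \<in> borel_measurable borel" unfolding G_def by measurable
    have "ennreal (f x) * ennreal (G x) = ennreal (G x * f x)" for x
      using ennreal_mult'[OF f0, of x "G x"] by (simp add: mult.commute)
    then have "(\<integral>\<^sup>+x. ennreal (G x) * indicator {0..} x \<partial>D) = (\<integral>\<^sup>+x\<in>{0..}. ennreal (G x * f x) \<partial>lborel)"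
      unfolding D by (subst nn_integral_density) (auto simp: mult.assoc[symmetric])
    then show ?thesis by (simp add: record_integral_def F G_def)
  qed
  have AE_supp: "AE x in D. x_minus < ereal x \<and> ereal x < x_plus"
    unfolding D using assms(7) by (subst AE_density) (auto intro!: AE_I2 intro: ccontr)
  have f_pos: "0 < f z" if "x_minus < ereal a" "ereal b < x_plus" "a < z" "z < b" for a b z
    using that less_trans[of x_minus "ereal a" "ereal z"] less_trans[of "ereal z" "ereal b" x_plus]
    by (intro assms(6)) auto
  have pos_gt: "0 < measure D {x<..}" if x: "ereal x < x_plus" for x
  proof -
    obtain a where a: "max (ereal x) x_minus < ereal a" "ereal a < x_plus"
      using ereal_dense2[of "max (ereal x) x_minus" x_plus] x assms(5) by auto
    obtain b where b: "ereal a < ereal b" "ereal b < x_plus" using ereal_dense2[OF a(2)] by auto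
    have "emeasure D {x<..} \<noteq> 0"
      unfolding D using a b
      by (intro density_pos_of_interval[of _ _ a b] f_pos[of a b]) auto
    then show ?thesis by (simp add: D.emeasure_eq_measure zero_less_measure_iff)
  qed
  have pos_lt: "0 < measure D {..<y}" if y: "x_minus < ereal y" for y
  proof -
    obtain b where b: "x_minus < ereal b" "ereal b < min (ereal y) x_plus"
      using ereal_dense2[of x_minus "min (ereal y) x_plus"] y assms(5) by auto
    obtain a where a: "x_minus < ereal a" "ereal a < ereal b" using ereal_dense2[OF b(1)] by auto
    have "emeasure D {..<y} \<noteq> 0"
      unfolding D using a b
      by (intro density_pos_of_interval[of _ _ a b] f_pos[of a b]) auto
    then show ?thesis by (simp add: D.emeasure_eq_measure zero_less_measure_iff)
  qed
  have zero: "measure D {..<y} = 0" if "ereal y \<le> x_minus" for y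
  proof -
    have "AE x in D. x \<notin> {..<y}"
      using AE_supp by eventually_elim (use that le_less_trans in fastforce)
    then show ?thesis by (subst D.prob_eq_0) auto
  qed
  have crit: "(\<Sum>k. record_prob D c \<delta> k) < \<infinity> \<longleftrightarrow>
      (c < 0 \<and> mu_plus f < \<infinity>) \<or>
      (c = 0 \<and> \<delta> > 0 \<and> record_integral \<delta> F f < \<infinity>) \<or>
      (c > 0 \<and> x_plus - x_minus \<le> ereal (\<delta> - c))"
  proof -
    consider "c < 0" | "c = 0" "\<delta> \<le> 0" | "c = 0" "0 < \<delta>" | "0 < c" by linarith
    then show ?thesis
    proof cases
      case 1
      then show ?thesis
        using D.record_prob_sum_finite_negative_drift[of c \<delta>] record_prob_sum_infinite[of c \<delta>]
        unfolding mu by (cases "mu_plus f = \<infinity>") (auto simp: less_top)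
    next
      case 2
      then show ?thesis using C.record_prob_sum_infinite_zero_drift by simp
    next
      case 3
      then show ?thesis using C.record_prob_sum_zero_drift_finite_iff[OF 3(2)] unfolding rec by simp
    next
      case 4
      show ?thesis
      proof (cases "x_plus - x_minus \<le> ereal (\<delta> - c)")
        \<comment> \<open>A finite upper bound on the length forces both endpoints to be
          real.\<close>
        case True
        then obtain a b where ab: "x_minus = ereal a" "x_plus = ereal b" "b - a \<le> \<delta> - c"
          using assms(5) by (cases x_minus; cases x_plus) auto
        \<comment> \<open>For \<open>x < b\<close> one has \<open>x + c - \<delta> < a\<close>, so
          the factor comparing with the immediate predecessor vanishes. Almost surely only the first
          observation is a record.\<close>
        have "record_prob D c \<delta> (Suc k) = 0" for k
        proof -
          have "AE x in D. (\<Prod>i\<in>{1..Suc k}. measure D {..<x + c * real i - \<delta>}) = 0"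
            using AE_supp
          proof eventually_elim
            case (elim x)
            then have "measure D {..<x + c * real 1 - \<delta>} = 0" using ab by (intro zero) simp
            then show ?case by (intro prod_zero bexI[of _ 1]) auto
          qed
          then have "record_prob D c \<delta> (Suc k) = (\<integral>\<^sup>+x. 0 \<partial>D)"
            unfolding D.record_prob_eq
            by (intro nn_integral_cong_AE) (erule eventually_mono, simp only: ennreal_0)
          then show ?thesis by simp
        qed
        then have "(\<Sum>k. record_prob D c \<delta> k) = record_prob D c \<delta> 0"
          by (subst suminf_finite[of "{0}"]) (auto simp: gr0_conv_Suc)
        also have "\<dots> < \<infinity>" by (simp add: D.record_prob_eq D.emeasure_space_1[simplified])
        finally show ?thesis using True 4 by simp
      next
        case False
        have "x_minus + ereal (\<delta> - c) < x_plus"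
          using False assms(5) by (cases x_minus; cases x_plus) auto
        \<comment> \<open>Such an \<open>x0\<close> has mass above it, and also mass below
          \<open>x0 + c - \<delta>\<close>, as the lower bound on the record probabilities
          requires.\<close>
        then obtain x0 where x0: "x_minus + ereal (\<delta> - c) < ereal x0" "ereal x0 < x_plus"
          using ereal_dense2 by blast
        have "x_minus < ereal (x0 + c - \<delta>)" using x0(1) by (cases x_minus) auto
        \<comment> \<open>The lower bound needs a finite mean of the positive part; for an infinite
          mean the series diverges whatever the drift.\<close>
        then have "(\<Sum>k. record_prob D c \<delta> k) = \<infinity>"
          using D.record_prob_sum_infinite_positive_drift[OF 4 _ pos_gt[OF x0(2)] pos_lt]
            record_prob_sum_infinite[of c \<delta>]
          by (cases "(\<integral>\<^sup>+x. ennreal x \<partial>D) = \<infinity>") (auto simp: less_top)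
        then show ?thesis using False 4 by simp
      qed
    qed
  qed
  show ?thesis
    unfolding N_def nn_integral_total_delta_records AE_finite_iff_record_prob crit by simp
qed

end
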